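(* Let $H\in(\tfrac12,1)$, $\sigma>0$. The law of $\mathcal{Y}_H$ is absolutely continuous with respect to Lebesgue measure, and its density $f_H$ is symmetric, bounded, belongs to $L^2(\mathbb{R})$, and has non-compact support.
   Context: $c_H=\sqrt{\frac{2H\,\Gamma(\frac32-H)}{\Gamma(H+\frac12)\Gamma(2-2H)}}$, $g_H=\frac{\sigma c_H}{H+\frac12}$, $h=\frac H2+\frac14$, $\rho_h(k)=\frac12((k+1)^{2h}+(k-1)^{2h}-2k^{2h})$; $(\xi_k)_{k\ge1}$ i.i.d. with $P(\xi_k=\pm1)=\frac12$; $\mathcal{Y}_H=2g_H\sum_{k=1}^\infty\rho_h(k)\xi_k$ (almost surely convergent). *)

theory Defs
  imports "HOL-Probability.Probability"
begin

definition c_H :: "real \<Rightarrow> real" where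
  "c_H H = sqrt (2 * H * Gamma (3/2 - H) / (Gamma (H + 1/2) * Gamma (2 - 2 * H)))"

definition g_H :: "real \<Rightarrow> real \<Rightarrow> real" where
  "g_H H \<sigma> = \<sigma> * c_H H / (H + 1/2)"

definition h_of :: "real \<Rightarrow> real" where
  "h_of H = H / 2 + 1 / 4"

definition rho_h :: "real \<Rightarrow> nat \<Rightarrow> real" where
  "rho_h h k = ((real k + 1) powr (2 * h) + (real k - 1) powr (2 * h) - 2 * real k powr (2 * h)) / 2"

definition Y_H :: "real \<Rightarrow> real \<Rightarrow> (nat \<Rightarrow> 'a \<Rightarrow> real) \<Rightarrow> 'a \<Rightarrow> real" where
  "Y_H H \<sigma> \<xi> \<omega> = 2 * g_H H \<sigma> * (\<Sum>k. rho_h (h_of H) (Suc k) * \<xi> (Suc k) \<omega>)"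

definition ess_support :: "(real \<Rightarrow> real) \<Rightarrow> real set" where
  "ess_support f = {x. \<forall>e>0. emeasure lborel {y \<in> ball x e. f y \<noteq> 0} > 0}"

end

theory Submission
  imports Defs
begin

text \<open>
  The coefficients of the series lie between two multiples of \<open>k powr (-\<alpha>)\<close> with
  \<open>\<alpha> = 3/2 - H\<close> in \<open>(1/2, 1)\<close>, hence are square summable but not summable. Square
  summability gives almost sure convergence (Kolmogorov), so the characteristic function is an
  infinite product of cosines. For large \<open>\<bar>t\<bar>\<close>, at least of the order of \<open>\<bar>t\<bar>\<close> factors are
  bounded away from \<open>1\<close>, so it decays exponentially and Fourier inversion yields a continuous
  bounded density, which is then in \<open>L\<^sup>2\<close>. Non-summability makes the series unbounded: with
  positive probability the first \<open>n\<close> signs are all \<open>1\<close> while, independently, the remaining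
  series stays below \<open>1\<close> in absolute value.
\<close>

section \<open>Series of independent random signs\<close>

text \<open>
  The partial sums of \<open>\<Sum>k. b k * x k\<close> frozen as soon as their modulus reaches \<open>e\<close>. Freezing
  keeps the increments orthogonal, so the second moment of the stopped sum controls the maximum
  of the partial sums.
\<close>

primrec stopped_sum :: "(nat \<Rightarrow> real) \<Rightarrow> real \<Rightarrow> nat \<Rightarrow> (nat \<Rightarrow> real) \<Rightarrow> real" where
  "stopped_sum b e 0 x = 0"
| "stopped_sum b e (Suc n) x =
    stopped_sum b e n x + (if \<bar>stopped_sum b e n x\<bar> < e then b n * x n else 0)"

text \<open>The index set \<open>J\<close> is left free for two uses: \<open>UNIV\<close> gives
  measurability on \<open>M\<close>, and \<open>{..<n}\<close> records that the stopped sum depends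
  on the first \<open>n\<close> signs only, as independence from \<open>X n\<close> demands.\<close>

lemma measurable_stopped_sum:
  "{..<n} \<subseteq> J \<Longrightarrow> stopped_sum b e n \<in> borel_measurable (PiM J (\<lambda>_. borel))"
proof (induction n)
  case 0
  have "stopped_sum b e 0 = (\<lambda>_. 0)" by (auto simp: fun_eq_iff)
  then show ?case by simp
next
  case (Suc n)
  then have [measurable]: "stopped_sum b e n \<in> borel_measurable (PiM J (\<lambda>_. borel))"
    by (auto simp: lessThan_Suc)
  have n: "n \<in> J" using Suc.prems by auto
  have [measurable]: "(\<lambda>x. x n) \<in> borel_measurable (PiM J (\<lambda>_. borel :: real measure))"
    using measurable_component_singleton[OF n, of "\<lambda>_. borel"] by simp
  have "(\<lambda>x. stopped_sum b e n x + (if \<bar>stopped_sum b e n x\<bar> < e then b n * x n else 0))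
      \<in> borel_measurable (PiM J (\<lambda>_. borel))"
    by measurable
  then show ?case by simp
qed

lemma stopped_sum_cong: "(\<And>k. k < n \<Longrightarrow> x k = y k) \<Longrightarrow> stopped_sum b e n x = stopped_sum b e n y"
  by (induction n) auto

lemma abs_stopped_sum_le: "(\<And>k. \<bar>x k\<bar> = 1) \<Longrightarrow> \<bar>stopped_sum b e n x\<bar> \<le> (\<Sum>k<n. \<bar>b k\<bar>)"
proof (induction n)
  case (Suc n)
  then have "\<bar>stopped_sum b e n x\<bar> \<le> (\<Sum>k<n. \<bar>b k\<bar>)" "\<bar>b n * x n\<bar> = \<bar>b n\<bar>"
    by (auto simp: abs_mult)
  then show ?case by auto
qed auto

text \<open>Once frozen, the value keeps modulus at least \<open>e\<close>; a sum never frozen is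
  the ordinary partial sum. So a partial sum reaching \<open>e\<close> at any time up to
  \<open>n\<close> is still visible in the single variable
  \<open>stopped_sum b e n x\<close>.\<close>

lemma stopped_sum_cases:
  "\<bar>stopped_sum b e n x\<bar> \<ge> e \<or>
   stopped_sum b e n x = (\<Sum>k<n. b k * x k) \<and> (\<forall>m\<le>n. \<bar>\<Sum>k<m. b k * x k\<bar> < e)"
proof (induction n)
  case (Suc n)
  then show ?case by (auto simp: le_Suc_eq)
qed auto

locale rademacher_sequence = prob_space +
  fixes X :: "nat \<Rightarrow> 'a \<Rightarrow> real"
  assumes indep: "indep_vars (\<lambda>_. borel) X UNIV"
    and prob_pos: "\<And>k. prob {\<omega> \<in> space M. X k \<omega> = 1} = 1/2"
    and prob_neg: "\<And>k. prob {\<omega> \<in> space M. X k \<omega> = -1} = 1/2"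
begin

lemma measurable_X [measurable]: "X k \<in> borel_measurable M"
  using indep by (auto simp: indep_vars_def)

lemma AE_sign: "AE \<omega> in M. X k \<omega> = 1 \<or> X k \<omega> = -1"
proof -
  have "prob ({\<omega> \<in> space M. X k \<omega> = 1} \<union> {\<omega> \<in> space M. X k \<omega> = -1}) =
      prob {\<omega> \<in> space M. X k \<omega> = 1} + prob {\<omega> \<in> space M. X k \<omega> = -1}"
    by (rule finite_measure_Union) auto
  then have "prob ({\<omega> \<in> space M. X k \<omega> = 1} \<union> {\<omega> \<in> space M. X k \<omega> = -1}) = 1"
    using prob_pos prob_neg by simp
  then have "AE \<omega> in M. \<omega> \<in> {\<omega> \<in> space M. X k \<omega> = 1} \<union> {\<omega> \<in> space M. X k \<omega> = -1}"
    by (subst (asm) prob_eq_1) auto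
  then show ?thesis by eventually_elim auto
qed

lemma AE_all_signs: "AE \<omega> in M. \<forall>k. X k \<omega> = 1 \<or> X k \<omega> = -1"
  using AE_sign by (simp add: AE_all_countable)

text \<open>The codomain is a general Banach space because the formula serves both the real mean of
  \<open>X k\<close> and the complex exponential in its characteristic function.\<close>

lemma expectation_compose:
  fixes g :: "real \<Rightarrow> 'b :: {banach, second_countable_topology}"
  assumes [measurable]: "g \<in> borel_measurable borel"
  shows "(LINT \<omega>|M. g (X k \<omega>)) = (1/2) *\<^sub>R (g 1 + g (-1))"
proof -
  let ?A = "{\<omega> \<in> space M. X k \<omega> = 1}" and ?B = "{\<omega> \<in> space M. X k \<omega> = -1}"
  have "(LINT \<omega>|M. g (X k \<omega>)) = (LINT \<omega>|M. indicator ?A \<omega> *\<^sub>R g 1 + indicator ?B \<omega> *\<^sub>R g (-1))"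
  proof (rule integral_cong_AE)
    show "AE \<omega> in M. g (X k \<omega>) = indicator ?A \<omega> *\<^sub>R g 1 + indicator ?B \<omega> *\<^sub>R g (-1)"
      using AE_sign[of k] AE_space by eventually_elim (auto simp: indicator_def)
  qed simp_all
  also have "\<dots> = (LINT \<omega>|M. indicator ?A \<omega> *\<^sub>R g 1) + (LINT \<omega>|M. indicator ?B \<omega> *\<^sub>R g (-1))"
    by (rule Bochner_Integration.integral_add)
      (auto intro!: integrable_scaleR_left integrable_real_indicator simp: emeasure_eq_measure)
  also have "\<dots> = (1/2) *\<^sub>R (g 1 + g (-1))"
    by (simp add: integrable_real_indicator emeasure_eq_measure scaleR_right_distrib)
      (simp only: prob_pos prob_neg)
  finally show ?thesis .
qed

lemma char_scaled_X: "char (distr M borel (\<lambda>\<omega>. c * X k \<omega>)) t = of_real (cos (t * c))"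
proof -
  have "char (distr M borel (\<lambda>\<omega>. c * X k \<omega>)) t = (CLINT \<omega>|M. iexp (t * (c * X k \<omega>)))"
    by (simp add: char_def integral_distr)
  also have "\<dots> = (1/2) *\<^sub>R (iexp (t * (c * 1)) + iexp (t * (c * (-1))))"
    by (rule expectation_compose) simp
  also have "\<dots> = of_real (cos (t * c))"
    by (simp add: complex_eq_iff Re_exp Im_exp)
  finally show ?thesis .
qed

section \<open>Kolmogorov's maximal inequality and almost sure convergence\<close>

lemma measurable_stopped_sum_X [measurable]:
  "(\<lambda>\<omega>. stopped_sum b e n (\<lambda>k. X k \<omega>)) \<in> borel_measurable M"
proof -
  have "(\<lambda>\<omega>. \<lambda>k\<in>UNIV. X k \<omega>) \<in> measurable M (PiM UNIV (\<lambda>_. borel))"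
    by measurable
  from measurable_compose[OF this measurable_stopped_sum[of n UNIV b e]] show ?thesis
    by (simp add: restrict_UNIV)
qed

text \<open>The increment at stage \<open>n\<close> is \<open>b n * Z * X n\<close>, where the
  indicator \<open>Z\<close> of not being frozen depends on earlier signs only. Independence and
  \<open>X n\<close> having mean zero remove the cross term, and the square of the increment
  contributes at most \<open>(b n)\<^sup>2\<close>.\<close>

lemma expectation_stopped_sum_power2:
  "integrable M (\<lambda>\<omega>. (stopped_sum b e n (\<lambda>k. X k \<omega>))\<^sup>2) \<and>
   expectation (\<lambda>\<omega>. (stopped_sum b e n (\<lambda>k. X k \<omega>))\<^sup>2) \<le> (\<Sum>k<n. (b k)\<^sup>2)"
proof (induction n)
  case (Suc n)
  define S where "S \<omega> = stopped_sum b e n (\<lambda>k. X k \<omega>)" for \<omega>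
  have [measurable]: "S \<in> borel_measurable M" unfolding S_def by measurable
  define Z where "Z \<omega> = (if \<bar>S \<omega>\<bar> < e then 1 else 0 :: real)" for \<omega>
  have [measurable]: "Z \<in> borel_measurable M" unfolding Z_def by measurable
  \<comment> \<open>This crude bound depends on \<open>n\<close> and serves only to make the cross
    term integrable.\<close>
  have bnd: "AE \<omega> in M. \<bar>S \<omega>\<bar> \<le> (\<Sum>k<n. \<bar>b k\<bar>)"
    using AE_all_signs
  proof eventually_elim
    case (elim \<omega>)
    then have "\<bar>X k \<omega>\<bar> = 1" for k by (metis abs_minus_cancel abs_one)
    then show ?case unfolding S_def by (rule abs_stopped_sum_le)
  qed
  have int1: "integrable M (\<lambda>\<omega>. S \<omega> * Z \<omega>)"
    by (rule integrable_const_bound[where B="\<Sum>k<n. \<bar>b k\<bar>"])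
      (use bnd in eventually_elim, auto simp: Z_def intro!: sum_nonneg)
  have int2: "integrable M (X n)"
    by (rule integrable_const_bound[where B=1]) (use AE_sign[of n] in eventually_elim, auto)
  have X0: "expectation (X n) = 0"
    using expectation_compose[of "\<lambda>x. x" n] by simp
  \<comment> \<open>Independence is available for blocks of coordinates, so \<open>S * Z\<close> is
    written as a function \<open>?F\<close> of the block \<open>{..<n}\<close> and compared with the
    block \<open>{n}\<close>.\<close>
  let ?F = "\<lambda>x. stopped_sum b e n x * (if \<bar>stopped_sum b e n x\<bar> < e then 1 else 0)"
  have "indep_var borel (?F \<circ> (\<lambda>\<omega>. restrict (\<lambda>i. X i \<omega>) {..<n}))
      borel ((\<lambda>x. x n) \<circ> (\<lambda>\<omega>. restrict (\<lambda>i. X i \<omega>) {n}))"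
  proof (rule indep_var_compose[OF indep_var_restrict[OF indep]])
    have [measurable]: "stopped_sum b e n \<in> borel_measurable (PiM {..<n} (\<lambda>_. borel))"
      by (rule measurable_stopped_sum) simp
    show "?F \<in> borel_measurable (PiM {..<n} (\<lambda>_. borel))"
      by measurable
  qed auto
  moreover have "?F \<circ> (\<lambda>\<omega>. restrict (\<lambda>i. X i \<omega>) {..<n}) = (\<lambda>\<omega>. S \<omega> * Z \<omega>)"
  proof
    fix \<omega>
    have "stopped_sum b e n (restrict (\<lambda>i. X i \<omega>) {..<n}) = S \<omega>"
      unfolding S_def by (rule stopped_sum_cong) auto
    then show "(?F \<circ> (\<lambda>\<omega>. restrict (\<lambda>i. X i \<omega>) {..<n})) \<omega> = S \<omega> * Z \<omega>"
      by (simp add: Z_def)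
  qed
  moreover have "((\<lambda>x. x n) \<circ> (\<lambda>\<omega>. restrict (\<lambda>i. X i \<omega>) {n})) = X n"
    by (auto simp: fun_eq_iff)
  ultimately have ind: "indep_var borel (\<lambda>\<omega>. S \<omega> * Z \<omega>) borel (X n)" by simp
  have int3: "integrable M (\<lambda>\<omega>. S \<omega> * Z \<omega> * X n \<omega>)"
    using indep_var_integrable[OF ind int1 int2] .
  have cross: "expectation (\<lambda>\<omega>. S \<omega> * Z \<omega> * X n \<omega>) = 0"
    using indep_var_lebesgue_integral[OF ind int1 int2] X0 by simp
  have int4: "integrable M (\<lambda>\<omega>. (Z \<omega>)\<^sup>2)"
    by (rule integrable_const_bound[where B=1]) (auto simp: Z_def)
  have le4: "expectation (\<lambda>\<omega>. (Z \<omega>)\<^sup>2) \<le> 1"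
    by (rule integral_le_const[OF int4]) (auto simp: Z_def)
  have eq: "AE \<omega> in M. (stopped_sum b e (Suc n) (\<lambda>k. X k \<omega>))\<^sup>2 =
      (S \<omega>)\<^sup>2 + 2 * b n * (S \<omega> * Z \<omega> * X n \<omega>) + (b n)\<^sup>2 * (Z \<omega>)\<^sup>2"
    using AE_sign[of n]
  proof eventually_elim
    case (elim \<omega>)
    then have "(X n \<omega>)\<^sup>2 = 1" by auto
    moreover have "stopped_sum b e (Suc n) (\<lambda>k. X k \<omega>) = S \<omega> + b n * Z \<omega> * X n \<omega>"
      by (simp add: S_def Z_def)
    moreover have "(S \<omega> + b n * Z \<omega> * X n \<omega>)\<^sup>2 =
      (S \<omega>)\<^sup>2 + 2 * b n * (S \<omega> * Z \<omega> * X n \<omega>) + (b n)\<^sup>2 * (Z \<omega>)\<^sup>2 * (X n \<omega>)\<^sup>2"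
      by (simp add: power2_eq_square algebra_simps)
    ultimately show ?case by simp
  qed
  have S: "integrable M (\<lambda>\<omega>. (S \<omega>)\<^sup>2)" "expectation (\<lambda>\<omega>. (S \<omega>)\<^sup>2) \<le> (\<Sum>k<n. (b k)\<^sup>2)"
    using Suc by (auto simp: S_def)
  have int: "integrable M (\<lambda>\<omega>. (S \<omega>)\<^sup>2 + 2 * b n * (S \<omega> * Z \<omega> * X n \<omega>) + (b n)\<^sup>2 * (Z \<omega>)\<^sup>2)"
    using S(1) int3 int4 by (intro Bochner_Integration.integrable_add integrable_mult_right) auto
  have "integrable M (\<lambda>\<omega>. (stopped_sum b e (Suc n) (\<lambda>k. X k \<omega>))\<^sup>2)"
    by (subst integrable_cong_AE[OF _ _ eq]) (use int in \<open>auto simp del: stopped_sum.simps\<close>)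
  moreover have "expectation (\<lambda>\<omega>. (stopped_sum b e (Suc n) (\<lambda>k. X k \<omega>))\<^sup>2) =
      expectation (\<lambda>\<omega>. (S \<omega>)\<^sup>2 + 2 * b n * (S \<omega> * Z \<omega> * X n \<omega>) + (b n)\<^sup>2 * (Z \<omega>)\<^sup>2)"
    by (rule integral_cong_AE[OF _ _ eq]) (auto simp del: stopped_sum.simps)
  moreover have "\<dots> = expectation (\<lambda>\<omega>. (S \<omega>)\<^sup>2) + 2 * b n * expectation (\<lambda>\<omega>. S \<omega> * Z \<omega> * X n \<omega>)
      + (b n)\<^sup>2 * expectation (\<lambda>\<omega>. (Z \<omega>)\<^sup>2)"
    using S(1) int3 int4 by (simp add: Bochner_Integration.integral_add)
  moreover have "\<dots> \<le> (\<Sum>k<n. (b k)\<^sup>2) + (b n)\<^sup>2 * 1"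
    unfolding cross using S(2) le4 by (intro add_mono mult_left_mono) auto
  ultimately show ?case by simp
qed simp

text \<open>Chebyshev's inequality for the stopped sum: by \<open>stopped_sum_cases\<close> its
  final modulus is at least \<open>e\<close> whenever some partial sum reaches
  \<open>e\<close>.\<close>

lemma maximal_inequality_finite:
  assumes "e > 0"
  shows "prob {\<omega> \<in> space M. \<exists>m\<le>n. \<bar>\<Sum>k<m. b k * X k \<omega>\<bar> \<ge> e} \<le> (\<Sum>k<n. (b k)\<^sup>2) / e\<^sup>2"
proof -
  let ?W = "\<lambda>\<omega>. stopped_sum b e n (\<lambda>k. X k \<omega>)"
  have "prob {\<omega> \<in> space M. \<exists>m\<le>n. \<bar>\<Sum>k<m. b k * X k \<omega>\<bar> \<ge> e} \<le> prob {\<omega> \<in> space M. \<bar>?W \<omega>\<bar> \<ge> e}"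
    using stopped_sum_cases[of e b n] by (intro finite_measure_mono) (auto simp: not_le[symmetric])
  also have "\<dots> \<le> expectation (\<lambda>\<omega>. (?W \<omega>)\<^sup>2) / e\<^sup>2"
    using expectation_stopped_sum_power2 assms by (intro second_moment_method) auto
  also have "\<dots> \<le> (\<Sum>k<n. (b k)\<^sup>2) / e\<^sup>2"
    using expectation_stopped_sum_power2 by (intro divide_right_mono) auto
  finally show ?thesis .
qed

lemma maximal_inequality:
  assumes "e > 0" and sb: "summable (\<lambda>k. (b k)\<^sup>2)"
  shows "prob {\<omega> \<in> space M. \<exists>m. \<bar>\<Sum>k<m. b k * X k \<omega>\<bar> \<ge> e} \<le> (\<Sum>k. (b k)\<^sup>2) / e\<^sup>2"
proof -
  let ?A = "\<lambda>n. {\<omega> \<in> space M. \<exists>m\<le>n. \<bar>\<Sum>k<m. b k * X k \<omega>\<bar> \<ge> e}"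
  have "(\<lambda>n. prob (?A n)) \<longlonglongrightarrow> prob (\<Union>n. ?A n)"
    by (rule finite_Lim_measure_incseq) (auto simp: incseq_def intro: order_trans)
  moreover have "(\<Union>n. ?A n) = {\<omega> \<in> space M. \<exists>m. \<bar>\<Sum>k<m. b k * X k \<omega>\<bar> \<ge> e}" by auto
  moreover have "prob (?A n) \<le> (\<Sum>k. (b k)\<^sup>2) / e\<^sup>2" for n
    by (rule order_trans[OF maximal_inequality_finite[OF assms(1)]])
      (intro divide_right_mono sum_le_suminf sb, auto)
  ultimately show ?thesis by (auto intro: LIMSEQ_le_const2)
qed

lemma maximal_inequality_tail:
  assumes "e > 0" and sb: "summable (\<lambda>k. (b k)\<^sup>2)"
  shows "prob {\<omega> \<in> space M. \<exists>m. \<bar>\<Sum>k\<in>{n..<m}. b k * X k \<omega>\<bar> \<ge> e} \<le> (\<Sum>k. (b (k + n))\<^sup>2) / e\<^sup>2"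
proof -
  \<comment> \<open>Zeroing the first \<open>n\<close> coefficients turns tail blocks into initial
    partial sums, so the previous inequality applies to \<open>c\<close>.\<close>
  define c where "c k = (if k < n then 0 else b k)" for k
  have s: "summable (\<lambda>k. (c k)\<^sup>2)"
    by (rule summable_comparison_test'[OF sb]) (auto simp: c_def)
  have "(\<Sum>k<m. c k * X k \<omega>) = (\<Sum>k\<in>{n..<m}. b k * X k \<omega>)" for m \<omega>
    by (rule sum.mono_neutral_cong_right) (auto simp: c_def)
  moreover have "(\<Sum>k. (c k)\<^sup>2) = (\<Sum>k. (b (k + n))\<^sup>2)"
    using suminf_split_initial_segment[OF s, of n] by (simp add: c_def)
  ultimately show ?thesis using maximal_inequality[OF assms(1) s] by simp
qed

text \<open>For fixed \<open>e\<close>, the event that after every \<open>n\<close> some block sum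
  reaches \<open>e\<close> has probability at most each tail of the sum of squares over
  \<open>e\<^sup>2\<close>, hence zero. Taking \<open>e = 1/(j+1)\<close> for all \<open>j\<close>
  yields the Cauchy criterion almost surely.\<close>

lemma AE_summable:
  assumes sb: "summable (\<lambda>k. (b k)\<^sup>2)"
  shows "AE \<omega> in M. summable (\<lambda>k. b k * X k \<omega>)"
proof -
  have "AE \<omega> in M. \<exists>n. \<forall>m. \<bar>\<Sum>k\<in>{n..<m}. b k * X k \<omega>\<bar> < e" if e: "e > 0" for e
  proof -
    let ?B = "{\<omega> \<in> space M. \<forall>n. \<exists>m. \<bar>\<Sum>k\<in>{n..<m}. b k * X k \<omega>\<bar> \<ge> e}"
    have "prob ?B \<le> (\<Sum>k. (b (k + n))\<^sup>2) / e\<^sup>2" for n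
      by (rule order_trans[OF _ maximal_inequality_tail[OF e sb]]) (intro finite_measure_mono, auto)
    moreover have "(\<lambda>n. (\<Sum>k. (b (k + n))\<^sup>2) / e\<^sup>2) \<longlonglongrightarrow> 0 / e\<^sup>2"
      by (intro tendsto_divide suminf_exist_split2[OF sb] tendsto_const) (use e in auto)
    ultimately have "prob ?B \<le> 0" by (auto intro: LIMSEQ_le_const)
    then have "prob ?B = 0" using measure_nonneg[of M ?B] by linarith
    then have "AE \<omega> in M. \<omega> \<notin> ?B" by (subst (asm) prob_eq_0) auto
    then show ?thesis using AE_space by eventually_elim (auto simp: not_le)
  qed
  then have "AE \<omega> in M. \<forall>j. \<exists>n. \<forall>m. \<bar>\<Sum>k\<in>{n..<m}. b k * X k \<omega>\<bar> < inverse (real (Suc j))"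
    unfolding AE_all_countable by auto
  then show ?thesis
  proof eventually_elim
    case (elim \<omega>)
    show ?case unfolding summable_Cauchy
    proof safe
      fix e :: real assume "e > 0"
      then obtain j where j: "inverse (real (Suc j)) < e / 2"
        using reals_Archimedean[of "e/2"] by auto
      obtain N where N: "\<And>m. \<bar>\<Sum>k\<in>{N..<m}. b k * X k \<omega>\<bar> < inverse (real (Suc j))"
        using elim by blast
      have "norm (\<Sum>k\<in>{m..<n}. b k * X k \<omega>) < e" if "m \<ge> N" for m n
      proof (cases "m \<le> n")
        case True
        \<comment> \<open>A block starting at \<open>m\<close> is the difference of two blocks
          starting at \<open>N\<close>, each smaller than \<open>e / 2\<close>.\<close>
        have "(\<Sum>k\<in>{N..<m}. b k * X k \<omega>) + (\<Sum>k\<in>{m..<n}. b k * X k \<omega>) = (\<Sum>k\<in>{N..<n}. b k * X k \<omega>)"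
          using that True by (intro sum.atLeastLessThan_concat)
        then show ?thesis using N[of m] N[of n] j by simp
      qed (use \<open>e > 0\<close> in auto)
      then show "\<exists>N. \<forall>m\<ge>N. \<forall>n. norm (\<Sum>k\<in>{m..<n}. b k * X k \<omega>) < e" by blast
    qed
  qed
qed

text \<open>Independence gives the finite products for the partial sums; almost sure convergence and
  the constant bound 1 on the exponentials allow passage to the limit by dominated
  convergence.\<close>

lemma char_series_tendsto:
  assumes sb: "summable (\<lambda>k. (b k)\<^sup>2)"
  shows "(\<lambda>n. complex_of_real (\<Prod>k<n. cos (t * b k)))
    \<longlonglongrightarrow> char (distr M borel (\<lambda>\<omega>. \<Sum>k. b k * X k \<omega>)) t"
proof -
  have "char (distr M borel (\<lambda>\<omega>. \<Sum>k<n. b k * X k \<omega>)) t = of_real (\<Prod>k<n. cos (t * b k))" for n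
  proof -
    have "indep_vars (\<lambda>_. borel) (\<lambda>k \<omega>. b k * X k \<omega>) {..<n}"
      by (rule indep_vars_compose2[OF indep_vars_subset[OF indep]]) auto
    from char_distr_sum[OF this] show ?thesis by (simp add: char_scaled_X)
  qed
  moreover have "(\<lambda>n. CLINT \<omega>|M. iexp (t * (\<Sum>k<n. b k * X k \<omega>))) \<longlonglongrightarrow>
      (CLINT \<omega>|M. iexp (t * (\<Sum>k. b k * X k \<omega>)))"
  proof (rule integral_dominated_convergence[where w="\<lambda>_. 1"])
    show "AE \<omega> in M. (\<lambda>n. iexp (t * (\<Sum>k<n. b k * X k \<omega>))) \<longlonglongrightarrow> iexp (t * (\<Sum>k. b k * X k \<omega>))"
      using AE_summable[OF sb]
      by eventually_elim (intro tendsto_intros summable_LIMSEQ)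
  qed auto
  ultimately show ?thesis by (simp add: char_def integral_distr)
qed

section \<open>Unboundedness of the series\<close>

lemma prob_initial_segment_all_one: "prob {\<omega> \<in> space M. \<forall>k<n. X k \<omega> = 1} = (1/2) ^ n"
proof (cases "n = 0")
  case False
  have "{\<omega> \<in> space M. \<forall>k<n. X k \<omega> = 1} = (\<Inter>k\<in>{..<n}. X k -` {1} \<inter> space M)"
    using False by auto
  then have "prob {\<omega> \<in> space M. \<forall>k<n. X k \<omega> = 1} = (\<Prod>k<n. prob (X k -` {1} \<inter> space M))"
    using indep_varsD[OF indep, of "{..<n}" "\<lambda>_. {1}"] False by (simp add: lessThan_empty_iff)
  moreover have "X k -` {1} \<inter> space M = {\<omega> \<in> space M. X k \<omega> = 1}" for k
    by auto
  ultimately show ?thesis using prob_pos by simp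
qed (simp add: prob_space)

lemma prob_series_gt:
  assumes sb: "summable (\<lambda>k. (b k)\<^sup>2)"
    and nb: "filterlim (\<lambda>n. \<Sum>k<n. b k) at_top sequentially"
  shows "prob {\<omega> \<in> space M. (\<Sum>k. b k * X k \<omega>) > r} > 0"
proof -
  \<comment> \<open>The head must exceed \<open>r + 1\<close> to absorb a tail of modulus below 1; a
    tail of squares below 1/2 makes such a tail have probability at least 1/2 by the maximal
    inequality at level 1.\<close>
  have "\<forall>\<^sub>F n in sequentially. (\<Sum>k<n. b k) > r + 1"
    using nb by (simp add: filterlim_at_top_dense)
  moreover have "\<forall>\<^sub>F n in sequentially. (\<Sum>k. (b (k + n))\<^sup>2) < 1/2"
    by (rule order_tendstoD(2)[OF suminf_exist_split2[OF sb]]) simp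
  ultimately have "\<forall>\<^sub>F n in sequentially. (\<Sum>k<n. b k) > r + 1 \<and> (\<Sum>k. (b (k + n))\<^sup>2) < 1/2"
    by (rule eventually_conj)
  then obtain n where n: "(\<Sum>k<n. b k) > r + 1" "(\<Sum>k. (b (k + n))\<^sup>2) < 1/2"
    by (auto simp: eventually_sequentially)
  \<comment> \<open>\<open>E\<close> (head all ones) and \<open>D\<close> (small tail blocks) are
    sets of sign sequences, so that independence of the two coordinate blocks can be applied to
    them.\<close>
  define D where "D = {x \<in> space (PiM {n..} (\<lambda>_. borel)). \<forall>m. \<bar>\<Sum>k\<in>{n..<m}. b k * x k\<bar> < (1::real)}"
  define E where "E = {x \<in> space (PiM {..<n} (\<lambda>_. borel)). \<forall>k<n. x k = (1::real)}"
  have D: "D \<in> sets (PiM {n..} (\<lambda>_. borel))"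
  proof -
    have [measurable]: "(\<lambda>x. \<Sum>k\<in>{n..<m}. b k * x k) \<in> borel_measurable (PiM {n..} (\<lambda>_. borel))" for m
      by (intro borel_measurable_sum borel_measurable_times measurable_component_singleton) auto
    show ?thesis unfolding D_def by measurable
  qed
  have E: "E \<in> sets (PiM {..<n} (\<lambda>_. borel))"
  proof -
    have "E = space (PiM {..<n} (\<lambda>_. borel)) \<inter> (\<Inter>k\<in>{..<n}. {x \<in> space (PiM {..<n} (\<lambda>_. borel)). x k = 1})"
      by (auto simp: E_def)
    also have "\<dots> \<in> sets (PiM {..<n} (\<lambda>_. borel))"
    proof (cases "n = 0")
      case False
      have "{x \<in> space (PiM {..<n} (\<lambda>_. borel)). x k = (1::real)} \<in> sets (PiM {..<n} (\<lambda>_. borel))" if "k < n" for k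
      proof -
        have [measurable]: "(\<lambda>x. x k) \<in> borel_measurable (PiM {..<n} (\<lambda>_. borel :: real measure))"
          using that by (intro measurable_component_singleton) auto
        show ?thesis by measurable
      qed
      then show ?thesis using False by (intro sets.Int sets.top sets.finite_INT) auto
    qed auto
    finally show ?thesis .
  qed
  let ?A = "\<lambda>\<omega>. restrict (\<lambda>i. X i \<omega>) {..<n}" and ?B = "\<lambda>\<omega>. restrict (\<lambda>i. X i \<omega>) {n..}"
  have "indep_var (PiM {..<n} (\<lambda>_. borel)) ?A (PiM {n..} (\<lambda>_. borel)) ?B"
    by (rule indep_var_restrict[OF indep]) auto
  from indep_varD[OF this E D]
  have prod: "prob ((\<lambda>\<omega>. (?A \<omega>, ?B \<omega>)) -` (E \<times> D) \<inter> space M) =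
      prob (?A -` E \<inter> space M) * prob (?B -` D \<inter> space M)" .
  have "?A -` E \<inter> space M = {\<omega> \<in> space M. \<forall>k<n. X k \<omega> = 1}"
    by (auto simp: E_def space_PiM)
  then have head: "prob (?A -` E \<inter> space M) > 0"
    using prob_initial_segment_all_one by simp
  have Deq: "?B -` D \<inter> space M = {\<omega> \<in> space M. \<forall>m. \<bar>\<Sum>k\<in>{n..<m}. b k * X k \<omega>\<bar> < 1}"
    by (auto simp: D_def space_PiM)
  have "prob {\<omega> \<in> space M. \<exists>m. \<bar>\<Sum>k\<in>{n..<m}. b k * X k \<omega>\<bar> \<ge> 1} \<le> 1/2"
    using maximal_inequality_tail[OF _ sb, of 1 n] n(2) by simp
  moreover have "?B -` D \<inter> space M = space M - {\<omega> \<in> space M. \<exists>m. \<bar>\<Sum>k\<in>{n..<m}. b k * X k \<omega>\<bar> \<ge> 1}"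
    unfolding Deq by (auto simp: not_le) (meson not_less)
  ultimately have tail: "prob (?B -` D \<inter> space M) > 0"
    by (simp add: prob_compl)
  \<comment> \<open>The inclusion of events holds only almost everywhere: the lower bound on the
    partial sums passes to \<open>suminf\<close> only where the series converges.\<close>
  have "AE \<omega> in M. \<omega> \<in> (\<lambda>\<omega>. (?A \<omega>, ?B \<omega>)) -` (E \<times> D) \<inter> space M \<longrightarrow> (\<Sum>k. b k * X k \<omega>) > r"
    using AE_summable[OF sb]
  proof (eventually_elim, safe)
    fix \<omega> assume s: "summable (\<lambda>k. b k * X k \<omega>)" and w: "\<omega> \<in> space M" "?A \<omega> \<in> E" "?B \<omega> \<in> D"
    have one: "X k \<omega> = 1" if "k < n" for k using w(2) that by (auto simp: E_def)
    have small: "\<bar>\<Sum>k\<in>{n..<m}. b k * X k \<omega>\<bar> < 1" for m using w Deq by blast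
    have "(\<Sum>k<n. b k) - 1 \<le> (\<Sum>k<m. b k * X k \<omega>)" if "m \<ge> n" for m
    proof -
      have "(\<Sum>k<m. b k * X k \<omega>) = (\<Sum>k<n. b k * X k \<omega>) + (\<Sum>k\<in>{n..<m}. b k * X k \<omega>)"
        using sum.atLeastLessThan_concat[of 0 n m "\<lambda>k. b k * X k \<omega>"] that by (simp add: atLeast0LessThan)
      moreover have "(\<Sum>k<n. b k * X k \<omega>) = (\<Sum>k<n. b k)" using one by simp
      ultimately show ?thesis using small[of m] by linarith
    qed
    then have "(\<Sum>k<n. b k) - 1 \<le> (\<Sum>k. b k * X k \<omega>)"
      using summable_LIMSEQ[OF s] by (intro LIMSEQ_le_const) auto
    then show "(\<Sum>k. b k * X k \<omega>) > r" using n(1) by linarith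
  qed
  then have "prob ((\<lambda>\<omega>. (?A \<omega>, ?B \<omega>)) -` (E \<times> D) \<inter> space M) \<le> prob {\<omega> \<in> space M. (\<Sum>k. b k * X k \<omega>) > r}"
    by (intro finite_measure_mono_AE) auto
  moreover have "0 < prob (?A -` E \<inter> space M) * prob (?B -` D \<inter> space M)"
    using head tail by (rule mult_pos_pos)
  ultimately show ?thesis using prod by linarith
qed

end

section \<open>Distributions with integrable characteristic function\<close>

text \<open>The Fourier inversion integral is kept complex; its real part will be the
  density.\<close>

definition inverse_char :: "real measure \<Rightarrow> real \<Rightarrow> complex" where
  "inverse_char M x = (CLBINT t. iexp (-(t * x)) * char M t) / of_real (2 * pi)"

text \<open>This is the inner integral after Fubini, and it produces exactly the kernel of Levy's
  inversion formula. The excluded point \<open>t = 0\<close> is a null set there.\<close>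

lemma integral_iexp_Icc:
  fixes a b t :: real
  assumes "a \<le> b" "t \<noteq> 0"
  shows "(CLBINT x. indicator {a..b} x *\<^sub>R iexp (-(t * x))) = (iexp (-(t * a)) - iexp (-(t * b))) / (\<i> * t)"
proof -
  have "(CLBINT x. indicator {a..b} x *\<^sub>R iexp (-(t * x))) = - iexp (-(t * b)) / (\<i> * t) - - iexp (-(t * a)) / (\<i> * t)"
  proof (rule integral_FTC_atLeastAtMost)
    fix x :: real
    have "((\<lambda>z. - exp (\<i> * (- (of_real t * z))) / (\<i> * t)) has_field_derivative iexp (-(t * x))) (at (of_real x))"
      using assms by (auto intro!: derivative_eq_intros simp: field_simps)
    from has_vector_derivative_real_field[OF this]
    show "((\<lambda>x. - iexp (-(t * x)) / (\<i> * t)) has_vector_derivative iexp (-(t * x))) (at x within {a..b})"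
      by (simp add: has_vector_derivative_at_within)
  qed (use assms in \<open>auto intro!: continuous_intros\<close>)
  also have "\<dots> = (iexp (-(t * a)) - iexp (-(t * b))) / (\<i> * t)"
    by (simp add: diff_divide_distrib)
  finally show ?thesis .
qed

context real_distribution
begin

context
  assumes int: "integrable lborel (char M)"
begin

lemma integrable_iexp_char: "integrable lborel (\<lambda>t. iexp (-(t * x)) * char M t)"
  by (rule Bochner_Integration.integrable_bound[OF int]) (auto simp: norm_mult)

lemma norm_inverse_char_le: "norm (inverse_char M x) \<le> (LBINT t. norm (char M t)) / (2 * pi)"
proof -
  have "norm (CLBINT t. iexp (-(t * x)) * char M t) \<le> (LBINT t. norm (iexp (-(t * x)) * char M t))"
    by (rule integral_norm_bound)
  then show ?thesis
    by (simp add: inverse_char_def norm_divide norm_mult divide_right_mono)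
qed

lemma continuous_inverse_char: "continuous_on UNIV (inverse_char M)"
proof -
  have "isCont (\<lambda>x. CLBINT t. iexp (-(t * x)) * char M t) x" for x
    unfolding continuous_at_sequentially comp_def
  proof safe
    fix u :: "nat \<Rightarrow> real" assume u: "u \<longlonglongrightarrow> x"
    show "(\<lambda>n. CLBINT t. iexp (-(t * u n)) * char M t) \<longlonglongrightarrow> (CLBINT t. iexp (-(t * x)) * char M t)"
    proof (rule integral_dominated_convergence[where w="\<lambda>t. norm (char M t)"])
      show "AE t in lborel. (\<lambda>n. iexp (-(t * u n)) * char M t) \<longlonglongrightarrow> iexp (-(t * x)) * char M t"
        using u by (intro AE_I2 tendsto_intros) auto
    qed (use int in \<open>auto simp: norm_mult\<close>)
  qed
  then show ?thesis
    unfolding inverse_char_def by (intro continuous_at_imp_continuous_on ballI continuous_intros) auto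
qed

lemma measurable_inverse_char [measurable]: "inverse_char M \<in> borel_measurable borel"
  by (rule borel_measurable_continuous_onI[OF continuous_inverse_char])

text \<open>Fubini exchanges the integrals; the majorant
  \<open>norm (char M t) * indicator {a..b} x\<close> is integrable on the product space.\<close>

lemma integral_inverse_char_Icc:
  assumes ab: "a \<le> b"
  shows "(CLBINT x. indicator {a..b} x *\<^sub>R inverse_char M x) =
    (CLBINT t. (iexp (-(t * a)) - iexp (-(t * b))) / (\<i> * t) * char M t) / of_real (2 * pi)"
proof -
  let ?f = "\<lambda>t x. (indicator {a..b} x *\<^sub>R iexp (-(t * x))) * char M t"
  have "(CLBINT x. indicator {a..b} x *\<^sub>R inverse_char M x) =
      (CLBINT x. (CLBINT t. ?f t x) / of_real (2 * pi))"
    unfolding inverse_char_def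
    by (intro Bochner_Integration.integral_cong refl) (auto simp: indicator_def)
  also have "\<dots> = (CLBINT x. (CLBINT t. ?f t x)) / of_real (2 * pi)"
    by simp
  also have "(CLBINT x. (CLBINT t. ?f t x)) = (CLBINT t. (CLBINT x. ?f t x))"
  proof (rule lborel_pair.Fubini_integral)
    have "integrable (lborel \<Otimes>\<^sub>M lborel) (\<lambda>(t, x). norm (char M t) * indicator {a..b} x)"
      by (rule lborel_pair.Fubini_integrable) (use int in \<open>auto simp: abs_mult emeasure_lborel_Icc_eq intro!: integrable_real_indicator\<close>)
    then show "integrable (lborel \<Otimes>\<^sub>M lborel) (case_prod ?f)"
    proof (rule Bochner_Integration.integrable_bound)
      show "case_prod ?f \<in> borel_measurable (lborel \<Otimes>\<^sub>M lborel)"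
        by measurable
    qed (auto simp: norm_mult indicator_def)
  qed
  also have "\<dots> = (CLBINT t. (iexp (-(t * a)) - iexp (-(t * b))) / (\<i> * t) * char M t)"
  proof (rule integral_cong_AE)
    have "AE t in lborel. (t::real) \<noteq> 0" by (rule AE_lborel_singleton)
    then show "AE t in lborel. (CLBINT x. ?f t x) = (iexp (-(t * a)) - iexp (-(t * b))) / (\<i> * t) * char M t"
    proof eventually_elim
      case (elim t)
      have "(CLBINT x. ?f t x) = (CLBINT x. indicator {a..b} x *\<^sub>R iexp (-(t * x))) * char M t"
        by (rule integral_mult_left_zero)
      then show ?case by (simp only: integral_iexp_Icc[OF ab elim])
    qed
    show "(\<lambda>t. CLBINT x. ?f t x) \<in> borel_measurable lborel" by measurable
  qed simp
  finally show ?thesis .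
qed

text \<open>Levy inversion expresses the mass as a limit of integrals over \<open>{-T<..<T}\<close>.
  The kernel is bounded by \<open>b - a\<close>, so dominated convergence replaces the limit by the
  full integral.\<close>

lemma measure_Ioc_eq_integral_no_atoms:
  assumes ab: "a \<le> b" and atoms: "measure M {a} = 0" "measure M {b} = 0"
  shows "of_real (measure M {a<..b}) = (CLBINT x. indicator {a..b} x *\<^sub>R inverse_char M x)"
proof -
  let ?F = "\<lambda>t. (iexp (-(t * a)) - iexp (-(t * b))) / (\<i> * t) * char M t"
  have bound: "norm (?F t) \<le> (b - a) * norm (char M t)" if "t \<noteq> 0" for t
    using Levy_Inversion_aux2[of "-b" "-a" t] ab that
    unfolding norm_mult by (intro mult_right_mono) auto
  have "(\<lambda>T::nat. CLBINT t. indicator {-real T<..<real T} t *\<^sub>R ?F t) \<longlonglongrightarrow> (CLBINT t. ?F t)"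
  proof (rule integral_dominated_convergence[where w="\<lambda>t. (b - a) * norm (char M t)"])
    have "(\<lambda>T::nat. indicator {-real T<..<real T} t *\<^sub>R ?F t) \<longlonglongrightarrow> ?F t" for t
    proof (rule tendsto_eventually)
      have "\<forall>\<^sub>F T in sequentially. real T > \<bar>t\<bar>"
        using filterlim_real_sequentially by (simp add: filterlim_at_top_dense)
      then show "\<forall>\<^sub>F T in sequentially. indicator {-real T<..<real T} t *\<^sub>R ?F t = ?F t"
        by eventually_elim (auto simp: indicator_def)
    qed
    then show "AE t in lborel. (\<lambda>T::nat. indicator {-real T<..<real T} t *\<^sub>R ?F t) \<longlonglongrightarrow> ?F t"
      by simp
    have "AE t in lborel. (t::real) \<noteq> 0" by (rule AE_lborel_singleton)
    then show "AE t in lborel. norm (indicator {-real T<..<real T} t *\<^sub>R ?F t) \<le> (b - a) * norm (char M t)" for T :: nat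
    proof eventually_elim
      case (elim t)
      show ?case using bound[OF elim] ab by (auto simp: indicator_def)
    qed
  qed (use int in auto)
  then have "(\<lambda>T::nat. 1 / (2 * pi) * (CLBINT t=-real T..real T. ?F t)) \<longlonglongrightarrow> 1 / (2 * pi) * (CLBINT t. ?F t)"
    by (intro tendsto_mult tendsto_const)
      (simp add: interval_lebesgue_integral_def set_lebesgue_integral_def)
  moreover have "(\<lambda>T::nat. 1 / (2 * pi) * (CLBINT t=-real T..real T. ?F t)) \<longlonglongrightarrow> of_real (measure M {a<..b})"
    using Levy_Inversion[OF ab atoms] by simp
  ultimately have "of_real (measure M {a<..b}) = 1 / (2 * pi) * (CLBINT t. ?F t)"
    using LIMSEQ_unique by blast
  then show ?thesis unfolding integral_inverse_char_Icc[OF ab] by simp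
qed

lemma norm_integral_inverse_char_Icc_le:
  assumes "a \<le> b"
  shows "norm (CLBINT x. indicator {a..b} x *\<^sub>R inverse_char M x) \<le> (LBINT t. norm (char M t)) / (2 * pi) * (b - a)"
proof -
  let ?B = "(LBINT t. norm (char M t)) / (2 * pi)"
  have "norm (CLBINT x. indicator {a..b} x *\<^sub>R inverse_char M x) \<le> (LBINT x. norm (indicator {a..b} x *\<^sub>R inverse_char M x))"
    by (rule integral_norm_bound)
  also have "\<dots> \<le> (LBINT x. ?B * indicator {a..b} x)"
  proof (rule Bochner_Integration.integral_mono')
    show "integrable lborel (\<lambda>x. ?B * indicator {a..b} x)"
      by (intro integrable_mult_right integrable_real_indicator) (auto simp: emeasure_lborel_Icc_eq)
    show "norm (indicator {a..b} x *\<^sub>R inverse_char M x) \<le> ?B * indicator {a..b} x" for x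
      using norm_inverse_char_le[of x] by (auto simp: indicator_def)
  qed auto
  also have "\<dots> = ?B * (b - a)" using assms by simp
  finally show ?thesis .
qed

text \<open>There are only countably many atoms, so any point lies in arbitrarily short intervals
  with atom-free endpoints. The mass of these is at most a constant times their length, which
  excludes an atom at the point.\<close>

lemma no_atoms: "measure M {x} = 0"
proof (rule ccontr)
  assume "measure M {x} \<noteq> 0"
  then have pos: "measure M {x} > 0" by (simp add: zero_less_measure_iff)
  let ?B = "(LBINT t. norm (char M t)) / (2 * pi)"
  have B0: "?B \<ge> 0" by simp
  \<comment> \<open>Chosen so that \<open>(?B + 1) * (2 * d)\<close> is exactly the mass of the
    atom; adding 1 keeps the denominator positive and the final inequality strict.\<close>
  define d where "d = measure M {x} / (2 * (?B + 1))"
  have d0: "d > 0" using pos B0 unfolding d_def by (intro divide_pos_pos mult_pos_pos) linarith+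
  have "uncountable {x-d<..<x}" "uncountable {x<..<x+d}"
    using d0 by (auto simp: uncountable_open_interval)
  then obtain a b where ab: "a \<in> {x-d<..<x}" "measure M {a} = 0" "b \<in> {x<..<x+d}" "measure M {b} = 0"
    using countable_subset[OF _ countable_support, of "{x-d<..<x}"]
      countable_subset[OF _ countable_support, of "{x<..<x+d}"] by blast
  then have le: "a \<le> b" by auto
  have "measure M {x} \<le> measure M {a<..b}"
    using ab by (intro finite_measure_mono) auto
  also have "\<dots> = norm (of_real (measure M {a<..b}) :: complex)" by simp
  also have "\<dots> \<le> ?B * (b - a)"
    unfolding measure_Ioc_eq_integral_no_atoms[OF le ab(2,4)]
    by (rule norm_integral_inverse_char_Icc_le[OF le])
  also have "\<dots> \<le> ?B * (2 * d)"
    using ab B0 by (intro mult_left_mono) auto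
  also have "\<dots> < (?B + 1) * (2 * d)" using d0 by (simp add: algebra_simps)
  also have "\<dots> = measure M {x}" using B0 by (simp add: d_def field_simps add_nonneg_eq_0_iff)
  finally show False by simp
qed

lemma integrable_inverse_char_Icc: "integrable lborel (\<lambda>x. indicator {a..b} x *\<^sub>R inverse_char M x)"
  using continuous_inverse_char borel_integrable_compact[of "{a..b}" "inverse_char M"]
  by (auto intro: continuous_on_subset simp: indicator_scaleR_eq_if)

lemma measure_Ioc_eq_integral:
  assumes "a \<le> b"
  shows "measure M {a<..b} = (LBINT x. indicator {a..b} x * Re (inverse_char M x))"
proof -
  have "measure M {a<..b} = Re (CLBINT x. indicator {a..b} x *\<^sub>R inverse_char M x)"
    using measure_Ioc_eq_integral_no_atoms[OF assms no_atoms no_atoms] by (metis Re_complex_of_real)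
  also have "\<dots> = (LBINT x. indicator {a..b} x * Re (inverse_char M x))"
    using integral_Re[OF integrable_inverse_char_Icc[of a b]] by simp
  finally show ?thesis .
qed

text \<open>A negative value at \<open>x\<close> would, by continuity, stay below half of itself on
  a short interval to the right of \<open>x\<close> and give that interval negative mass.\<close>

lemma Re_inverse_char_nonneg: "0 \<le> Re (inverse_char M x)"
proof (rule ccontr)
  assume "\<not> ?thesis"
  then have neg: "Re (inverse_char M x) < 0" by simp
  have "isCont (\<lambda>x. Re (inverse_char M x)) x"
    using continuous_inverse_char by (intro isCont_Re) (auto simp: continuous_on_eq_continuous_at)
  then have "\<forall>\<^sub>F y in at x. Re (inverse_char M y) < Re (inverse_char M x) / 2"
    unfolding isCont_def by (rule order_tendstoD) (use neg in simp)
  then obtain d where d: "d > 0" "\<And>y. y \<noteq> x \<Longrightarrow> dist y x < d \<Longrightarrow> Re (inverse_char M y) < Re (inverse_char M x) / 2"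
    unfolding eventually_at by auto
  let ?b = "x + d / 2"
  have i: "integrable lborel (\<lambda>y. indicator {x..?b} y * Re (inverse_char M y))"
    using integrable_Re[OF integrable_inverse_char_Icc[of x ?b]] by simp
  have "0 \<le> measure M {x<..?b}" by simp
  also have "\<dots> = (LBINT y. indicator {x..?b} y * Re (inverse_char M y))"
    by (rule measure_Ioc_eq_integral) (use d in simp)
  also have "\<dots> \<le> (LBINT y. indicator {x..?b} y * (Re (inverse_char M x) / 2))"
  proof (rule integral_mono[OF i])
    show "integrable lborel (\<lambda>y. indicator {x..?b} y * (Re (inverse_char M x) / 2))"
      by (intro integrable_mult_left integrable_real_indicator) (auto simp: emeasure_lborel_Icc_eq)
    show "indicator {x..?b} y * Re (inverse_char M y) \<le> indicator {x..?b} y * (Re (inverse_char M x) / 2)" for y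
      using d(2)[of y] neg d(1) by (cases "y = x") (auto simp: indicator_def dist_real_def)
  qed
  also have "\<dots> = d / 2 * (Re (inverse_char M x) / 2)" using d by simp
  also have "\<dots> < 0" using d neg by (intro mult_pos_neg) auto
  finally show False by simp
qed

text \<open>Half-open intervals form an intersection-stable generator of the Borel sets, so
  agreement on them suffices; passing from \<open>{a<..b}\<close> to \<open>{a..b}\<close> changes
  the integral by a null set.\<close>

theorem eq_density_inverse_char: "M = density lborel (\<lambda>x. ennreal (Re (inverse_char M x)))"
proof (rule measure_eqI_generator_eq[where \<Omega>=UNIV])
  let ?E = "range (\<lambda>(a, b). {a<..b::real})"
  show "Int_stable ?E"
    unfolding Int_stable_def by (auto intro!: image_eqI simp: Int_greaterThanAtMost)
  show "sets M = sigma_sets UNIV ?E" "sets (density lborel (\<lambda>x. ennreal (Re (inverse_char M x)))) = sigma_sets UNIV ?E"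
    by (simp_all add: borel_sigma_sets_Ioc)
  show "range (\<lambda>i::nat. {-(real i)<..real i}) \<subseteq> ?E" by auto
  show "(\<Union>i::nat. {-(real i)<..real i}) = UNIV" by (rule UN_Ioc_eq_UNIV)
  show "emeasure M {-(real i)<..real i} \<noteq> \<infinity>" for i by (simp add: emeasure_eq_measure)
  fix Y assume "Y \<in> ?E"
  then obtain a b where Y: "Y = {a<..b}" by auto
  show "emeasure M Y = emeasure (density lborel (\<lambda>x. ennreal (Re (inverse_char M x)))) Y"
  proof (cases "a \<le> b")
    case True
    have "emeasure (density lborel (\<lambda>x. ennreal (Re (inverse_char M x)))) Y =
        (\<integral>\<^sup>+x. ennreal (Re (inverse_char M x)) * indicator {a<..b} x \<partial>lborel)"
      unfolding Y by (rule emeasure_density) auto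
    also have "\<dots> = (\<integral>\<^sup>+x. ennreal (indicator {a..b} x * Re (inverse_char M x)) \<partial>lborel)"
      by (rule nn_integral_cong_AE, use AE_lborel_singleton[of a] in eventually_elim) (auto simp: indicator_def)
    also have "\<dots> = ennreal (LBINT x. indicator {a..b} x * Re (inverse_char M x))"
      using Re_inverse_char_nonneg integrable_Re[OF integrable_inverse_char_Icc[of a b]]
      by (intro nn_integral_eq_integral) auto
    finally show ?thesis using measure_Ioc_eq_integral[OF True] Y by (simp add: emeasure_eq_measure)
  qed (simp add: Y)
qed auto

text \<open>For a real characteristic function the real part of the integrand is
  \<open>cos (t * x) * Re (char M t)\<close>, which is even in \<open>x\<close>.\<close>

lemma Re_inverse_char_minus:
  assumes "\<And>t. Im (char M t) = 0"
  shows "Re (inverse_char M (-x)) = Re (inverse_char M x)"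
proof -
  have "Re (CLBINT t. iexp (-(t * x)) * char M t) = (LBINT t. cos (t * x) * Re (char M t))" for x
    unfolding integral_Re[OF integrable_iexp_char, symmetric] using assms by (simp add: Re_exp)
  from this[of x] this[of "-x"] show ?thesis by (simp add: inverse_char_def Re_divide_of_real)
qed

end
end

text \<open>Off the essential support every point has a ball on which \<open>f\<close> vanishes
  almost everywhere. Lindelof leaves countably many such balls, so \<open>f\<close> vanishes almost
  everywhere beyond any bound \<open>r\<close> of the support.\<close>

lemma compact_ess_support_imp_emeasure_eq_0:
  assumes [measurable]: "f \<in> borel_measurable borel" and K: "compact (ess_support f)"
  shows "\<exists>r. emeasure (density lborel (\<lambda>x. ennreal (f x))) {r<..} = 0"
proof -
  obtain r where r: "\<And>x. x \<in> ess_support f \<Longrightarrow> \<bar>x\<bar> \<le> r"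
    using compact_imp_bounded[OF K] by (auto simp: bounded_iff)
  define \<F> where "\<F> = {ball x e | x e. emeasure lborel {y \<in> ball x e. f y \<noteq> 0} = 0}"
  obtain \<G> where G: "\<G> \<subseteq> \<F>" "countable \<G>" "\<Union>\<G> = \<Union>\<F>"
    by (rule Lindelof[of \<F>]) (auto simp: \<F>_def)
  have null: "{y \<in> S. f y \<noteq> 0} \<in> null_sets lborel" if "S \<in> \<G>" for S
    using that G(1) by (auto simp: \<F>_def null_sets_def)
  have "(\<Union>S\<in>\<G>. {y \<in> S. f y \<noteq> 0}) \<in> null_sets lborel"
    by (rule null_sets_UN'[OF G(2) null])
  then have "AE y in lborel. y \<notin> (\<Union>S\<in>\<G>. {y \<in> S. f y \<noteq> 0})"
    by (rule AE_not_in)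
  then have "AE y in lborel. y \<in> {r<..} \<longrightarrow> ennreal (f y) \<le> 0"
  proof eventually_elim
    case (elim y)
    show ?case
    proof
      assume "y \<in> {r<..}"
      then have "y \<notin> ess_support f" using r[of y] by auto
      then obtain e where "e > 0" "ball y e \<in> \<F>"
        by (auto simp: ess_support_def \<F>_def zero_less_iff_neq_zero)
      then have "y \<in> \<Union>\<G>" unfolding G(3) by (auto intro!: bexI[of _ "ball y e"])
      then show "ennreal (f y) \<le> 0" using elim by auto
    qed
  qed
  then have "{r<..} \<in> null_sets (density lborel (\<lambda>x. ennreal (f x)))"
    by (subst null_sets_density_iff) auto
  then show ?thesis by auto
qed

section \<open>Coefficients with power decay\<close>

text \<open>The mean value theorem is used twice: for \<open>(y + 1) powr p - y powr p\<close> on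
  \<open>[x - 1, x]\<close>, then for the difference of derivatives. The condition
  \<open>x > 1\<close> keeps all bases positive.\<close>

lemma second_difference_powr:
  fixes p x :: real
  assumes x: "x > 1"
  shows "\<exists>z. x - 1 < z \<and> z < x + 1 \<and>
    (x + 1) powr p + (x - 1) powr p - 2 * x powr p = p * (p - 1) * z powr (p - 2)"
proof -
  have "\<exists>y. x - 1 < y \<and> y < x \<and> ((x + 1) powr p - x powr p) - ((x - 1 + 1) powr p - (x - 1) powr p) =
      (x - (x - 1)) * (p * (y + 1) powr (p - 1) - p * y powr (p - 1))"
    by (rule MVT2) (use x in \<open>auto intro!: derivative_eq_intros\<close>)
  then obtain y where y: "x - 1 < y" "y < x"
    "(x + 1) powr p + (x - 1) powr p - 2 * x powr p = p * ((y + 1) powr (p - 1) - y powr (p - 1))"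
    by (auto simp: algebra_simps)
  have "\<exists>z. y < z \<and> z < y + 1 \<and> (y + 1) powr (p - 1) - y powr (p - 1) =
      (y + 1 - y) * ((p - 1) * z powr (p - 1 - 1))"
    by (rule MVT2) (use x y in \<open>auto intro!: derivative_eq_intros\<close>)
  then obtain z where "y < z" "z < y + 1"
    "(y + 1) powr (p - 1) - y powr (p - 1) = (p - 1) * z powr (p - 2)"
    by auto
  with y show ?thesis by (intro exI[of _ z]) auto
qed

text \<open>The intermediate point \<open>z\<close> of the second difference lies between
  \<open>k / 2\<close> and \<open>2 * k\<close> once \<open>k >= 2\<close>, and the exponent
  \<open>2 * h - 2\<close> is negative.\<close>

lemma rho_h_bounds:
  assumes h: "1 < 2 * h" "2 * h < 2" and k: "k \<ge> 2"
  shows "h * (2 * h - 1) * 2 powr (2 * h - 2) * real k powr (2 * h - 2) \<le> rho_h h k"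
    and "rho_h h k \<le> h * (2 * h - 1) * 2 powr (2 - 2 * h) * real k powr (2 * h - 2)"
proof -
  obtain z where z: "real k - 1 < z" "z < real k + 1" "rho_h h k = h * (2 * h - 1) * z powr (2 * h - 2)"
    using second_difference_powr[of "real k" "2 * h"] k unfolding rho_h_def by auto
  have c: "h * (2 * h - 1) \<ge> 0" using h by (intro mult_nonneg_nonneg) auto
  have "(2 * real k) powr (2 * h - 2) \<le> z powr (2 * h - 2)"
    using z k h by (intro powr_mono2') auto
  then show "h * (2 * h - 1) * 2 powr (2 * h - 2) * real k powr (2 * h - 2) \<le> rho_h h k"
    unfolding z(3) mult.assoc[of "h * (2 * h - 1)"] using c by (intro mult_left_mono) (auto simp: powr_mult)
  have "z powr (2 * h - 2) \<le> (real k / 2) powr (2 * h - 2)"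
    using z k h by (intro powr_mono2') auto
  also have "\<dots> = 2 powr (2 - 2 * h) * real k powr (2 * h - 2)"
    using powr_minus_divide[of 2 "2 * h - 2"] by (simp add: powr_divide)
  finally show "rho_h h k \<le> h * (2 * h - 1) * 2 powr (2 - 2 * h) * real k powr (2 * h - 2)"
    unfolding z(3) mult.assoc[of "h * (2 * h - 1)"] using c by (intro mult_left_mono)
qed

text \<open>On \<open>[0, 1]\<close>, which lies below \<open>pi / 3\<close>, \<open>cos\<close> is
  at least 1/2. Integrating twice gives \<open>sin v >= v / 2\<close> and then
  \<open>cos y <= 1 - y\<^sup>2 / 4\<close>, which is below the exponential.\<close>

lemma abs_cos_le_exp:
  fixes x :: real
  assumes "\<bar>x\<bar> \<le> 1"
  shows "\<bar>cos x\<bar> \<le> exp (- x\<^sup>2 / 4)"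
proof -
  have main: "cos y \<le> 1 - y\<^sup>2 / 4" "0 \<le> cos y" if y: "0 \<le> y" "y \<le> 1" for y :: real
  proof -
    have cos_ge: "1 / 2 \<le> cos v" if "0 \<le> v" "v \<le> 1" for v :: real
      using cos_monotone_0_pi_le[of v "pi / 3"] that pi_gt3 by (simp add: cos_60)
    have sin_ge: "v / 2 \<le> sin v" if "0 \<le> v" "v \<le> 1" for v :: real
    proof -
      have "sin 0 - 0 / 2 \<le> sin v - v / 2"
      proof (rule DERIV_nonneg_imp_nondecreasing[OF that(1)])
        fix u assume "0 \<le> u" "u \<le> v"
        then show "\<exists>y. ((\<lambda>v. sin v - v / 2) has_real_derivative y) (at u) \<and> 0 \<le> y"
          using cos_ge[of u] that by (intro exI[of _ "cos u - 1 / 2"]) (auto intro!: derivative_eq_intros)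
      qed
      then show ?thesis by simp
    qed
    have "1 - 0\<^sup>2 / 4 - cos 0 \<le> 1 - y\<^sup>2 / 4 - cos y"
    proof (rule DERIV_nonneg_imp_nondecreasing[OF y(1)])
      fix u assume "0 \<le> u" "u \<le> y"
      then show "\<exists>d. ((\<lambda>v. 1 - v\<^sup>2 / 4 - cos v) has_real_derivative d) (at u) \<and> 0 \<le> d"
        using sin_ge[of u] y by (intro exI[of _ "sin u - u / 2"]) (auto intro!: derivative_eq_intros)
    qed
    then show "cos y \<le> 1 - y\<^sup>2 / 4" by simp
    show "0 \<le> cos y" using cos_ge[OF y] by simp
  qed
  have "\<bar>cos x\<bar> = cos \<bar>x\<bar>" using main(2)[of "\<bar>x\<bar>"] assms by simp
  also have "\<dots> \<le> 1 + (- x\<^sup>2 / 4)" using main(1)[of "\<bar>x\<bar>"] assms by simp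
  also have "\<dots> \<le> exp (- x\<^sup>2 / 4)" by (rule exp_ge_add_one_self)
  finally show ?thesis .
qed

lemma integrable_exp_minus_abs:
  fixes c :: real
  assumes c: "c > 0"
  shows "integrable lborel (\<lambda>t. exp (- c * \<bar>t\<bar>))"
proof -
  let ?g = "\<lambda>t. indicator {0<..} t *\<^sub>R exp (- (t * c))"
  have g: "integrable lborel ?g"
    using integrable_I0i_exp_mscale[OF c] unfolding set_integrable_def .
  have g': "integrable lborel (\<lambda>t. ?g (- t))"
    using lborel_integrable_real_affine[OF g, of "-1" 0] by simp
  have "AE t in lborel. ?g t + ?g (- t) = exp (- c * \<bar>t\<bar>)"
    using AE_lborel_singleton[of 0] by eventually_elim (auto simp: indicator_def)
  then show ?thesis
    by (intro integrable_cong_AE_imp[OF Bochner_Integration.integrable_add[OF g g']]) auto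
qed

text \<open>Bounds start at \<open>k = 1\<close>: \<open>b k\<close> will be a multiple of
  \<open>rho_h h (Suc k)\<close>, and the estimates for \<open>rho_h\<close> need argument at least
  2. Nothing is assumed about \<open>b 0\<close>.\<close>

locale power_decay =
  fixes b :: "nat \<Rightarrow> real" and \<alpha> c1 c2 :: real
  assumes \<alpha>: "1/2 < \<alpha>" "\<alpha> < 1" and c1: "c1 > 0"
    and lower: "\<And>k. k \<ge> 1 \<Longrightarrow> c1 * real (Suc k) powr (-\<alpha>) \<le> b k"
    and upper: "\<And>k. k \<ge> 1 \<Longrightarrow> b k \<le> c2 * real (Suc k) powr (-\<alpha>)"
begin

lemma c2: "c2 > 0"
proof -
  have "c1 * real (Suc 1) powr (-\<alpha>) \<le> c2 * real (Suc 1) powr (-\<alpha>)"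
    using lower[of 1] upper[of 1] by linarith
  then show ?thesis using c1 by simp
qed

lemma nonneg: "k \<ge> 1 \<Longrightarrow> b k \<ge> 0"
  by (rule order_trans[OF _ lower]) (use c1 in auto)

lemma summable_power2: "summable (\<lambda>k. (b k)\<^sup>2)"
proof (rule summable_comparison_test')
  have "summable (\<lambda>k. real (Suc k) powr (-2 * \<alpha>))"
    by (subst summable_Suc_iff[of "\<lambda>k. real k powr (-2 * \<alpha>)"]) (use \<alpha> in \<open>simp add: summable_real_powr_iff\<close>)
  then show "summable (\<lambda>k. c2\<^sup>2 * real (Suc k) powr (-2 * \<alpha>))" by (rule summable_mult)
  fix k :: nat assume k: "k \<ge> 1"
  have "norm ((b k)\<^sup>2) = (b k)\<^sup>2" by simp
  also have "\<dots> \<le> (c2 * real (Suc k) powr (-\<alpha>))\<^sup>2"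
    using upper[OF k] nonneg[OF k] by (intro power_mono)
  also have "\<dots> = c2\<^sup>2 * real (Suc k) powr (-2 * \<alpha>)"
    by (simp add: power_mult_distrib power2_eq_square powr_add[symmetric])
  finally show "norm ((b k)\<^sup>2) \<le> c2\<^sup>2 * real (Suc k) powr (-2 * \<alpha>)" .
qed

lemma sum_at_top: "filterlim (\<lambda>n. \<Sum>k<n. b k) at_top sequentially"
proof (rule filterlim_at_top_mono)
  have "filterlim (\<lambda>n. real n powr (1 - \<alpha>)) at_top sequentially"
    using \<alpha> by (intro filterlim_compose[OF real_powr_at_top filterlim_real_sequentially]) auto
  then show "filterlim (\<lambda>n. (b 0 - c1) + c1 * real n powr (1 - \<alpha>)) at_top sequentially"
    using c1 by (intro filterlim_tendsto_add_at_top[OF tendsto_const] filterlim_tendsto_pos_mult_at_top[OF tendsto_const])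
  show "\<forall>\<^sub>F n in sequentially. (b 0 - c1) + c1 * real n powr (1 - \<alpha>) \<le> (\<Sum>k<n. b k)"
    using eventually_gt_at_top[of 0]
  proof eventually_elim
    case (elim n)
    have "(b 0 - c1) + c1 * real n powr (1 - \<alpha>) = (b 0 - c1) + (\<Sum>k<n. c1 * real n powr (-\<alpha>))"
      using elim powr_add[of "real n" 1 "-\<alpha>"] by simp
    also have "\<dots> \<le> (b 0 - c1) + (\<Sum>k<n. c1 * real (Suc k) powr (-\<alpha>))"
      using c1 \<alpha> by (intro add_left_mono sum_mono mult_left_mono powr_mono2') auto
    \<comment> \<open>The extra summand repairs the uncontrolled term \<open>k = 0\<close>,
      replacing \<open>b 0\<close> by \<open>c1\<close>; it accounts for the offset
      \<open>b 0 - c1\<close>.\<close>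
    also have "(\<Sum>k<n. c1 * real (Suc k) powr (-\<alpha>)) \<le> (\<Sum>k<n. b k + (if k = 0 then c1 - b 0 else 0))"
      by (intro sum_mono) (use lower in auto)
    also have "(b 0 - c1) + \<dots> = (\<Sum>k<n. b k)"
      using elim by (simp add: sum.distrib)
    finally show ?case by simp
  qed
qed

text \<open>For large \<open>\<bar>t\<bar>\<close> there are at least \<open>c2 \<bar>t\<bar>\<close> indices \<open>k\<close> with \<open>\<bar>t\<bar> b k\<close> in a fixed
  interval \<open>[q, 1]\<close>, and each contributes a factor bounded away from \<open>1\<close>.\<close>

lemma prod_cos_decay:
  obtains C T where "C > 0" "T > 0"
    "\<And>t. \<bar>t\<bar> \<ge> T \<Longrightarrow> \<forall>\<^sub>F n in sequentially. \<bar>\<Prod>k<n. cos (t * b k)\<bar> \<le> exp (- C * \<bar>t\<bar>)"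
proof
  \<comment> \<open>\<open>q\<close> is the value of
    \<open>s * (c1 * (4 * R) powr (-\<alpha>))\<close>, the lower bound for
    \<open>\<bar>t\<bar> * b k\<close> as long as \<open>Suc k <= 4 * R\<close>.\<close>
  define q where "q = c1 * 4 powr (-\<alpha>) / c2"
  have q: "q > 0" using c1 c2 by (simp add: q_def)
  show "q\<^sup>2 * c2 / 4 > 0" "1 / c2 > 0" using q c2 by simp_all
  fix t :: real
  assume t: "\<bar>t\<bar> \<ge> 1 / c2"
  define s where "s = \<bar>t\<bar>"
  have s: "c2 * s \<ge> 1" "s > 0" using t c2 by (auto simp: s_def field_simps intro: less_le_trans[OF divide_pos_pos])
  \<comment> \<open>\<open>R\<close> solves \<open>s * c2 * R powr (-\<alpha>) = 1\<close>, so
    \<open>\<bar>t\<bar> * b k <= 1\<close> for \<open>k >= R\<close>. Since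
    \<open>c2 * s >= 1\<close> and \<open>1 / \<alpha> > 1\<close>, it is at least
    \<open>c2 * s\<close>, hence at least 1, and rounding up at most doubles it.\<close>
  define R where "R = (c2 * s) powr (1 / \<alpha>)"
  have R1: "R \<ge> c2 * s"
    using powr_mono[of 1 "1 / \<alpha>" "c2 * s"] s \<alpha> by (simp add: R_def)
  have R\<alpha>: "R powr (-\<alpha>) = 1 / (c2 * s)"
    using s c2 \<alpha> by (simp add: R_def powr_powr powr_minus_divide)
  define K where "K = nat \<lceil>R\<rceil>"
  have K: "R \<le> real K" "real K \<le> 2 * R" "K \<ge> 1"
    using R1 s unfolding K_def by linarith+
  have factor: "\<bar>cos (t * b k)\<bar> \<le> exp (- q\<^sup>2 / 4)" if k: "k \<in> {K..<2 * K}" for k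
  proof -
    have k1: "k \<ge> 1" using k K by auto
    have "\<bar>t * b k\<bar> = s * b k" using nonneg[OF k1] by (simp add: s_def abs_mult)
    also have "s * b k \<le> s * (c2 * R powr (-\<alpha>))"
    proof -
      have "real (Suc k) powr (-\<alpha>) \<le> R powr (-\<alpha>)"
        using k K R1 s \<alpha> by (intro powr_mono2') auto
      then have "b k \<le> c2 * R powr (-\<alpha>)"
        using upper[OF k1] c2 by (meson mult_le_cancel_left_pos order_trans)
      then show ?thesis using s by (intro mult_left_mono) auto
    qed
    also have "\<dots> = 1" using R\<alpha> s c2 by simp
    finally have le1: "\<bar>t * b k\<bar> \<le> 1" .
    have "q = s * (c1 * (4 * R) powr (-\<alpha>))"
      using R1 s c2 by (simp add: powr_mult R\<alpha> q_def)
    also have "\<dots> \<le> s * b k"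
    proof -
      have "(4 * R) powr (-\<alpha>) \<le> real (Suc k) powr (-\<alpha>)"
        using k K \<alpha> by (intro powr_mono2') auto
      then have "c1 * (4 * R) powr (-\<alpha>) \<le> b k"
        using lower[OF k1] c1 by (meson mult_le_cancel_left_pos order_trans)
      then show ?thesis using s by (intro mult_left_mono) auto
    qed
    also have "\<dots> = \<bar>t * b k\<bar>" using nonneg[OF k1] by (simp add: s_def abs_mult)
    finally have "q\<^sup>2 \<le> (t * b k)\<^sup>2"
      using q by (metis abs_le_square_iff abs_of_pos)
    then have "exp (- (t * b k)\<^sup>2 / 4) \<le> exp (- q\<^sup>2 / 4)" by simp
    with abs_cos_le_exp[OF le1] show ?thesis by (rule order_trans)
  qed
  show "\<forall>\<^sub>F n in sequentially. \<bar>\<Prod>k<n. cos (t * b k)\<bar> \<le> exp (- (q\<^sup>2 * c2 / 4) * \<bar>t\<bar>)"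
    using eventually_ge_at_top[of "2 * K"]
  proof eventually_elim
    case (elim n)
    have "\<bar>\<Prod>k<n. cos (t * b k)\<bar> = (\<Prod>k<n. \<bar>cos (t * b k)\<bar>)"
      by (rule abs_prod)
    also have "\<dots> \<le> (\<Prod>k<n. if k \<in> {K..<2*K} then exp (- q\<^sup>2 / 4) else 1)"
      using factor by (intro prod_mono) auto
    also have "\<dots> = exp (- q\<^sup>2 / 4) ^ K"
    proof -
      have "{..<n} \<inter> {k. K \<le> k \<and> k < 2 * K} = {K..<2 * K}" using elim by auto
      then show ?thesis by (simp add: prod.If_cases)
    qed
    also have "\<dots> = exp (real K * (- q\<^sup>2 / 4))" by (rule exp_of_nat_mult[symmetric])
    \<comment> \<open>The \<open>K\<close> good factors number at least
      \<open>c2 * \<bar>t\<bar>\<close>, which turns the power into exponential decay in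
      \<open>\<bar>t\<bar>\<close>.\<close>
    also have "\<dots> \<le> exp (- (q\<^sup>2 * c2 / 4) * \<bar>t\<bar>)"
    proof -
      have "(c2 * s) * (q\<^sup>2 / 4) \<le> real K * (q\<^sup>2 / 4)"
        using K R1 by (intro mult_right_mono) auto
      then show ?thesis by (simp add: s_def algebra_simps)
    qed
    finally show ?case .
  qed
qed

end

section \<open>The law of the series\<close>

text \<open>The shift of index is obtained by grouping the family into the disjoint singleton blocks
  \<open>{Suc j}\<close> and reading off the only coordinate of each.\<close>

lemma (in prob_space) indep_vars_Suc:
  assumes "indep_vars (\<lambda>_. borel) \<xi> {1..}"
  shows "indep_vars (\<lambda>_. borel) (\<lambda>k. \<xi> (Suc k)) UNIV"
proof -
  have "indep_vars (\<lambda>j. PiM {Suc j} (\<lambda>_. borel)) (\<lambda>j \<omega>. restrict (\<lambda>i. \<xi> i \<omega>) {Suc j}) UNIV"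
    by (rule indep_vars_restrict[OF assms]) (auto simp: disjoint_family_on_def)
  then have "indep_vars (\<lambda>_. borel) (\<lambda>j \<omega>. (restrict (\<lambda>i. \<xi> i \<omega>) {Suc j}) (Suc j)) UNIV"
    by (rule indep_vars_compose2) (auto intro: measurable_component_singleton)
  then show ?thesis by simp
qed

lemma g_H_pos:
  assumes "1/2 < H" "H < 1" "\<sigma> > 0"
  shows "g_H H \<sigma> > 0"
proof -
  have "Gamma (3/2 - H) > 0" "Gamma (H + 1/2) > 0" "Gamma (2 - 2 * H) > 0"
    using assms by (auto intro!: Gamma_real_pos)
  then have "c_H H > 0" using assms by (simp add: c_H_def)
  then show ?thesis using assms by (simp add: g_H_def)
qed

theorem theorem5p5:
  fixes M :: "'a measure" and \<xi> :: "nat \<Rightarrow> 'a \<Rightarrow> real" and H \<sigma> :: real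
  assumes "prob_space M"
    and "1/2 < H" "H < 1" "\<sigma> > 0"
    and "prob_space.indep_vars M (\<lambda>_. borel) \<xi> {1..}"
    and "\<And>k. k \<ge> 1 \<Longrightarrow> \<xi> k \<in> borel_measurable M"
    and "\<And>k. k \<ge> 1 \<Longrightarrow> \<P>(\<omega> in M. \<xi> k \<omega> = 1) = 1/2"
    and "\<And>k. k \<ge> 1 \<Longrightarrow> \<P>(\<omega> in M. \<xi> k \<omega> = -1) = 1/2"
  shows "\<exists>f :: real \<Rightarrow> real.
           f \<in> borel_measurable borel \<and> (\<forall>x. 0 \<le> f x) \<and>
           distributed M lborel (Y_H H \<sigma> \<xi>) (\<lambda>x. ennreal (f x)) \<and>
           (\<forall>x. f (- x) = f x) \<and>
           (\<exists>B. \<forall>x. f x \<le> B) \<and>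
           integrable lborel (\<lambda>x. (f x)\<^sup>2) \<and>
           \<not> compact (ess_support f)"
proof -
  interpret prob_space M by fact
  define X where "X k = \<xi> (Suc k)" for k
  interpret rademacher_sequence M X
  proof
    show "indep_vars (\<lambda>_. borel) X UNIV"
      unfolding X_def by (rule indep_vars_Suc[OF assms(5)])
    show "prob {\<omega> \<in> space M. X k \<omega> = 1} = 1/2" "prob {\<omega> \<in> space M. X k \<omega> = -1} = 1/2" for k
      unfolding X_def by (rule assms(7) assms(8), simp)+
  qed
  define h where "h = h_of H"
  \<comment> \<open>Here \<open>2 * h = H + 1/2\<close>, so the decay exponent
    \<open>2 - 2 * h\<close> equals \<open>3/2 - H\<close>.\<close>
  have h: "1 < 2 * h" "2 * h < 3/2" using assms(2,3) by (auto simp: h_def h_of_def)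
  define g where "g = 2 * g_H H \<sigma>"
  have g: "g > 0" using g_H_pos[OF assms(2-4)] by (simp add: g_def)
  define b where "b k = g * rho_h h (Suc k)" for k
  define c1 where "c1 = g * (h * (2 * h - 1) * 2 powr (2 * h - 2))"
  define c2 where "c2 = g * (h * (2 * h - 1) * 2 powr (2 - 2 * h))"
  interpret power_decay b "2 - 2 * h" c1 c2
  proof
    show "1/2 < 2 - 2 * h" "2 - 2 * h < 1" using h by auto
    show "c1 > 0" unfolding c1_def using g h by (intro mult_pos_pos) auto
    fix k :: nat assume k: "k \<ge> 1"
    have h2: "2 * h < 2" and k2: "Suc k \<ge> 2" using h k by auto
    show "c1 * real (Suc k) powr - (2 - 2 * h) \<le> b k"
      using mult_left_mono[OF rho_h_bounds(1)[OF h(1) h2 k2], of g] g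
      by (simp add: c1_def b_def mult.assoc)
    show "b k \<le> c2 * real (Suc k) powr - (2 - 2 * h)"
      using mult_left_mono[OF rho_h_bounds(2)[OF h(1) h2 k2], of g] g
      by (simp add: c2_def b_def mult.assoc)
  qed
  let ?S = "\<lambda>\<omega>. \<Sum>k. b k * X k \<omega>"
  define D where "D = distr M borel ?S"
  interpret D: real_distribution D
    unfolding D_def by (rule real_distribution_distr) measurable
  have lim: "(\<lambda>n. complex_of_real (\<Prod>k<n. cos (t * b k))) \<longlonglongrightarrow> char D t" for t
    unfolding D_def by (rule char_series_tendsto[OF summable_power2])
  have real: "Im (char D t) = 0" for t
    using tendsto_Im[OF lim[of t]] by (simp add: LIMSEQ_const_iff del: of_real_prod)
  obtain C T where C: "C > 0" and T: "T > 0" and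
    decay: "\<And>t. \<bar>t\<bar> \<ge> T \<Longrightarrow> \<forall>\<^sub>F n in sequentially. \<bar>\<Prod>k<n. cos (t * b k)\<bar> \<le> exp (- C * \<bar>t\<bar>)"
    by (rule prod_cos_decay) blast
  \<comment> \<open>The factor \<open>exp (C * T)\<close> makes the bound at least 1 for
    \<open>\<bar>t\<bar> < T\<close>, where only the trivial bound on a characteristic function is
    available.\<close>
  have char_le: "norm (char D t) \<le> exp (C * T) * exp (- C * \<bar>t\<bar>)" for t
  proof (cases "\<bar>t\<bar> \<ge> T")
    case True
    then have "norm (char D t) \<le> exp (- C * \<bar>t\<bar>)"
      using decay[of t] by (intro tendsto_upperbound[OF tendsto_norm[OF lim]]) (auto simp del: of_real_prod)
    also have "\<dots> \<le> exp (C * T) * exp (- C * \<bar>t\<bar>)"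
      using T C by simp
    finally show ?thesis .
  next
    case False
    then have "C * \<bar>t\<bar> \<le> C * T" using C by simp
    then have "1 \<le> exp (C * T) * exp (- C * \<bar>t\<bar>)" by (simp add: exp_add[symmetric])
    with D.cmod_char_le_1 show ?thesis by (rule order_trans)
  qed
  have int: "integrable lborel (char D)"
  proof (rule Bochner_Integration.integrable_bound)
    show "integrable lborel (\<lambda>t. exp (C * T) * exp (- C * \<bar>t\<bar>))"
      using integrable_exp_minus_abs[OF C] by (rule integrable_mult_right)
  qed (use char_le in auto)
  define f where "f x = Re (inverse_char D x)" for x
  have f_meas: "f \<in> borel_measurable borel"
    using D.measurable_inverse_char[OF int] unfolding f_def by measurable
  have f_nonneg: "0 \<le> f x" for x
    unfolding f_def by (rule D.Re_inverse_char_nonneg[OF int])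
  have D_eq: "D = density lborel (\<lambda>x. ennreal (f x))"
    unfolding f_def by (rule D.eq_density_inverse_char[OF int])
  define B where "B = (LBINT t. norm (char D t)) / (2 * pi)"
  have f_le: "f x \<le> B" for x
    unfolding f_def B_def by (rule order_trans[OF complex_Re_le_cmod D.norm_inverse_char_le[OF int]])
  have Y_meas: "Y_H H \<sigma> \<xi> \<in> borel_measurable M"
    using measurable_X unfolding Y_H_def X_def by measurable
  \<comment> \<open>Pulling \<open>g\<close> out of \<open>suminf\<close> uses convergence, so the
    two variables are compared almost everywhere, which is enough for equal laws.\<close>
  have "AE \<omega> in M. ?S \<omega> = Y_H H \<sigma> \<xi> \<omega>"
    using AE_summable[OF summable_power2]
  proof eventually_elim
    case (elim \<omega>)
    have "(\<lambda>k. rho_h h (Suc k) * X k \<omega>) = (\<lambda>k. inverse g * (b k * X k \<omega>))"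
      using g by (auto simp: b_def field_simps)
    then have "summable (\<lambda>k. rho_h h (Suc k) * X k \<omega>)"
      using summable_mult[OF elim, of "inverse g"] by simp
    from suminf_mult[OF this, of g] show ?case
      by (simp add: Y_H_def b_def X_def g_def h_def mult.assoc)
  qed
  then have "distr M lborel (Y_H H \<sigma> \<xi>) = D"
    unfolding D_def using Y_meas by (intro distr_cong_AE) (auto simp: eq_commute)
  then have distributed: "distributed M lborel (Y_H H \<sigma> \<xi>) (\<lambda>x. ennreal (f x))"
    unfolding distributed_def using D_eq f_meas Y_meas by simp
  have f_int: "integrable lborel f"
  proof (rule integrableI_nonneg)
    have "(\<integral>\<^sup>+x. ennreal (f x) \<partial>lborel) = emeasure D UNIV"
      unfolding D_eq using f_meas by (subst emeasure_density) auto
    also have "\<dots> < \<infinity>" by (simp add: D.emeasure_eq_measure)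
    finally show "(\<integral>\<^sup>+x. ennreal (f x) \<partial>lborel) < \<infinity>" .
  qed (use f_meas f_nonneg in auto)
  have "integrable lborel (\<lambda>x. (f x)\<^sup>2)"
  proof (rule Bochner_Integration.integrable_bound)
    show "integrable lborel (\<lambda>x. B * f x)" using f_int by simp
    \<comment> \<open>A bounded integrable density is square integrable, with \<open>B * f\<close>
      as majorant.\<close>
    have "(f x)\<^sup>2 \<le> B * f x" for x
      using mult_right_mono[OF f_le f_nonneg, of x x] by (simp add: power2_eq_square)
    then show "AE x in lborel. norm ((f x)\<^sup>2) \<le> norm (B * f x)"
      by (intro AE_I2) (metis abs_ge_self order_trans power2_abs real_norm_def abs_of_nonneg zero_le_power2)
  qed (use f_meas in simp)
  moreover have "\<not> compact (ess_support f)"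
  proof
    assume "compact (ess_support f)"
    from compact_ess_support_imp_emeasure_eq_0[OF f_meas this]
    obtain r where "emeasure D {r<..} = 0" using D_eq by auto
    then have "prob (?S -` {r<..} \<inter> space M) = 0"
      unfolding D_def by (subst (asm) emeasure_distr) (auto simp: emeasure_eq_measure)
    moreover have "?S -` {r<..} \<inter> space M = {\<omega> \<in> space M. ?S \<omega> > r}" by auto
    ultimately show False using prob_series_gt[OF summable_power2 sum_at_top, of r] by simp
  qed
  moreover have "f (- x) = f x" for x
    unfolding f_def by (rule D.Re_inverse_char_minus[OF int real])
  ultimately show ?thesis
    using f_meas f_nonneg distributed f_le by blast
qed

end
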